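(* Let $I\subseteq\{1,2,3,\ldots\}$, let $T=T(t)=\sum_{a\in I}t^a$, and put $C=1-T$, $$\alpha=\frac{C+(C+2)t+\sqrt{C^2-(2C^2+4C+4)t+(C+2)^2t^2}}{2(1+C)t},$$ $$\beta=\frac{C+(C+2)t-\sqrt{C^2-(2C^2+4C+4)t+(C+2)^2t^2}}{2(1+C)t},\qquad A=\frac{\alpha\,(t-1)}{(1+C)(\alpha-\beta)},$$ regarded as formal Laurent series in $t$. Then the generating function $P(t)=\sum_{n\ge 0}p_nt^n$ of the number $p_n$ of Catalan $I$-queen paths from $(0,0)$ to $(n,n)$ is $$P(t)=\frac{1+\dfrac{A}{t(1-\alpha)}}{1+C+\dfrac{(2-T)A}{t\alpha(1-\alpha)}}.$$
   Context: A lattice path with step set $S\subseteq\mathbb{N}\times\mathbb{N}$ from $(0,0)$ to $(n,m)$ is a finite (possibly empty) sequence of steps in $S$ summing to $(n,m)$; its nodes are $(0,0)$ and the points reached after each step. The path is Catalan if every node $(x,y)$ satisfies $x<y+1$, i.e. $x\le y$. An $I$-queen path is a path with step set $S=\{(a,0),(0,a):a>0\}\cup\{(a,a):a\in I\}$. The square root denotes the formal power series square root with constant term $1$. *)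

theory Defs
  imports
    "HOL-Library.Product_Plus"
    "HOL-Computational_Algebra.Formal_Laurent_Series"
begin

text \<open>A path from \<open>(0,0)\<close> is represented by its list of steps; addition of points is
  componentwise (\<^theory>\<open>HOL-Library.Product_Plus\<close>).\<close>

definition lattice_paths :: "(nat \<times> nat) set \<Rightarrow> nat \<times> nat \<Rightarrow> (nat \<times> nat) list set" where
  "lattice_paths S p = {xs. set xs \<subseteq> S \<and> sum_list xs = p}"

definition path_nodes :: "(nat \<times> nat) list \<Rightarrow> (nat \<times> nat) set" where
  "path_nodes xs = {sum_list (take k xs) |k. k \<le> length xs}"

definition catalan_path :: "(nat \<times> nat) list \<Rightarrow> bool" where
  "catalan_path xs \<longleftrightarrow> (\<forall>(x, y)\<in>path_nodes xs. x < y + 1)"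

definition queen_steps :: "nat set \<Rightarrow> (nat \<times> nat) set" where
  "queen_steps I = {(a, 0) |a. a > 0} \<union> {(0, a) |a. a > 0} \<union> {(a, a) |a. a \<in> I}"

definition catalan_queen_paths :: "nat set \<Rightarrow> nat \<Rightarrow> (nat \<times> nat) list set" where
  "catalan_queen_paths I n = {xs \<in> lattice_paths (queen_steps I) (n, n). catalan_path xs}"

text \<open>The sets counted below are finite, so their \<^const>\<open>card\<close> is the true number of paths.\<close>

lemma length_le_sum_list:
  assumes "(0, 0) \<notin> set xs"
  shows "length xs \<le> fst (sum_list xs) + snd (sum_list xs)"
  using assms
proof (induction xs)
  case (Cons x xs)
  have "1 \<le> fst x + snd x" using Cons.prems by (cases x) auto
  with Cons show ?case by simp
qed simp

lemma step_le_sum_list: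
  fixes x :: "nat \<times> nat"
  assumes "x \<in> set xs"
  shows "fst x \<le> fst (sum_list xs) \<and> snd x \<le> snd (sum_list xs)"
  using assms by (induction xs) (auto simp: trans_le_add1 trans_le_add2)

lemma finite_catalan_queen_paths:
  assumes "I \<subseteq> {1..}"
  shows "finite (catalan_queen_paths I n)"
proof (rule finite_subset)
  show "catalan_queen_paths I n \<subseteq> {xs. set xs \<subseteq> {..n} \<times> {..n} \<and> length xs \<le> n + n}"
  proof
    fix xs assume xs: "xs \<in> catalan_queen_paths I n"
    then have s: "sum_list xs = (n, n)" and "(0, 0) \<notin> set xs"
      using assms
      by (auto simp: catalan_queen_paths_def lattice_paths_def queen_steps_def)
    then have "length xs \<le> n + n" using length_le_sum_list[of xs] by simp
    moreover have "set xs \<subseteq> {..n} \<times> {..n}"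
      using step_le_sum_list[of _ xs] s by fastforce
    ultimately show "xs \<in> {xs. set xs \<subseteq> {..n} \<times> {..n} \<and> length xs \<le> n + n}" by simp
  qed
  show "finite {xs. set xs \<subseteq> {..n} \<times> {..n} \<and> length xs \<le> n + n}"
    by (rule finite_lists_length_le) simp
qed

definition catalan_queen_gf :: "nat set \<Rightarrow> rat fps" where
  "catalan_queen_gf I = Abs_fps (\<lambda>n. of_nat (card (catalan_queen_paths I n)))"

text \<open>The first argument of \<^const>\<open>fps_radical\<close> prescribes the constant term of the root. It is
  \<open>1\<close> here, so this is a square root only for series with constant term \<open>1\<close>.\<close>

definition fps_sqrt :: "'a::field_char_0 fps \<Rightarrow> 'a fps" where
  "fps_sqrt f = fps_radical (\<lambda>_ _. 1) 2 f"

lemma fps_sqrt_correct: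
  assumes "fps_nth f 0 = 1"
  shows "fps_sqrt f ^ 2 = f" and "fps_nth (fps_sqrt f) 0 = 1"
  using power_radical[of f "\<lambda>_ _. 1" 1] assms
  by (simp_all add: fps_sqrt_def numeral_2_eq_2)

end

theory Submission
  imports Defs
begin

text \<open>Let \<open>F\<^sub>d(t)\<close> count Catalan queen paths to \<open>(n, n + d)\<close> by \<open>t\<^sup>n\<close>, and let
  \<open>V\<^sub>d = \<Sum>\<^sub>k t\<^sup>k F\<^bsub>d+k\<^esub>\<close>, summed over \<open>k \<ge> 1\<close>. Removing the last step gives
  \<open>C F\<^sub>d = [d = 0] + \<Sum>\<^bsub>e<d\<^esub> F\<^sub>e + V\<^sub>d\<close> and \<open>V\<^sub>d = t (F\<^bsub>d+1\<^esub> + V\<^bsub>d+1\<^esub>)\<close>, and this system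
  determines all coefficients recursively. Its second difference is a linear recurrence in \<open>d\<close>
  with characteristic roots \<open>\<alpha>\<close> and \<open>\<beta>\<close>; only \<open>\<beta>\<close> is a power series, so \<open>F\<^sub>d\<close> is geometric
  in \<open>\<beta>\<close> for \<open>d \<ge> 1\<close>, which yields \<open>F\<^sub>0 = D / (C D - t)\<close> with \<open>D = C - (1 + C) t \<beta>\<close>.
  The stated formula follows from this by \<open>\<alpha> \<beta> = 1 / t\<close>.\<close>

section \<open>Counting Catalan queen paths by their last step\<close>

definition catalan_queen_paths_to :: "nat set \<Rightarrow> nat \<Rightarrow> nat \<Rightarrow> (nat \<times> nat) list set" where
  "catalan_queen_paths_to I n m = {xs \<in> lattice_paths (queen_steps I) (n, m). catalan_path xs}"

definition queen_count :: "nat set \<Rightarrow> nat \<Rightarrow> nat \<Rightarrow> rat" where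
  "queen_count I n m = of_nat (card (catalan_queen_paths_to I n m))"

lemma path_nodes_Nil: "path_nodes [] = {0}"
  by (auto simp: path_nodes_def)

lemma path_nodes_snoc: "path_nodes (xs @ [s]) = insert (sum_list xs + s) (path_nodes xs)"
proof -
  have "path_nodes (xs @ [s]) = (\<lambda>k. sum_list (take k (xs @ [s]))) ` {..Suc (length xs)}"
    by (auto simp: path_nodes_def)
  also have "\<dots> = insert (sum_list xs + s) ((\<lambda>k. sum_list (take k (xs @ [s]))) ` {..length xs})"
    by (simp add: atMost_Suc)
  also have "(\<lambda>k. sum_list (take k (xs @ [s]))) ` {..length xs} = path_nodes xs"
    by (auto simp: path_nodes_def)
  finally show ?thesis .
qed

lemma catalan_path_Nil: "catalan_path []"
  by (simp add: catalan_path_def path_nodes_Nil zero_prod_def)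

lemma catalan_path_snoc:
  "catalan_path (xs @ [s]) \<longleftrightarrow>
    catalan_path xs \<and> fst (sum_list (xs @ [s])) \<le> snd (sum_list (xs @ [s]))"
  by (cases "sum_list (xs @ [s])")
    (auto simp: catalan_path_def path_nodes_snoc less_Suc_eq_le simp flip: fst_add snd_add)

lemma finite_catalan_queen_paths_to:
  assumes "I \<subseteq> {1..}"
  shows "finite (catalan_queen_paths_to I n m)"
proof (rule finite_subset)
  show "catalan_queen_paths_to I n m \<subseteq> {xs. set xs \<subseteq> {..n} \<times> {..m} \<and> length xs \<le> n + m}"
  proof
    fix xs assume xs: "xs \<in> catalan_queen_paths_to I n m"
    then have s: "sum_list xs = (n, m)" and "(0, 0) \<notin> set xs"
      using assms
      by (auto simp: catalan_queen_paths_to_def lattice_paths_def queen_steps_def)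
    then have "length xs \<le> n + m" using length_le_sum_list[of xs] by simp
    moreover have "set xs \<subseteq> {..n} \<times> {..m}"
      using step_le_sum_list[of _ xs] s by fastforce
    ultimately show "xs \<in> {xs. set xs \<subseteq> {..n} \<times> {..m} \<and> length xs \<le> n + m}" by simp
  qed
  show "finite {xs. set xs \<subseteq> {..n} \<times> {..m} \<and> length xs \<le> n + m}"
    by (rule finite_lists_length_le) simp
qed

text \<open>The endpoint is itself a node. This allows sums over the points of a column to be cut
  off at the diagonal.\<close>

lemma queen_count_eq_0:
  assumes "m < n"
  shows "queen_count I n m = 0"
proof -
  have False if "xs \<in> catalan_queen_paths_to I n m" for xs
    using that assms
    by (cases xs rule: rev_cases)
      (auto simp: catalan_queen_paths_to_def lattice_paths_def catalan_path_snoc zero_prod_def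
        simp flip: fst_add snd_add)
  then have "catalan_queen_paths_to I n m = {}" by blast
  then show ?thesis by (simp add: queen_count_def)
qed

text \<open>Steps that fit into the endpoint form a finite set on which truncated subtraction is
  exact. By \<open>n \<le> m\<close> the last node is harmless, so only the remaining prefix has to
  be Catalan.\<close>

lemma catalan_queen_paths_to_last_step:
  fixes I n m
  assumes "n \<le> m"
  defines "St \<equiv> (\<lambda>a. (a, 0)) ` {1..n} \<union> (\<lambda>a. (0, a)) ` {1..m} \<union> (\<lambda>a. (a, a)) ` {a \<in> I. a \<le> n}"
  shows "catalan_queen_paths_to I n m = (if (n, m) = (0, 0) then {[]} else {}) \<union>
    (\<Union>s\<in>St. (\<lambda>ys. ys @ [s]) ` catalan_queen_paths_to I (n - fst s) (m - snd s))"
    (is "?L = ?R")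
proof (rule set_eqI)
  fix xs
  have St: "s \<in> St \<longleftrightarrow> s \<in> queen_steps I \<and> fst s \<le> n \<and> snd s \<le> m" for s
    using assms(1) by (cases s) (auto simp: St_def queen_steps_def image_iff)
  show "xs \<in> ?L \<longleftrightarrow> xs \<in> ?R"
  proof (cases xs rule: rev_cases)
    case Nil
    then show ?thesis
      by (auto simp: catalan_queen_paths_to_def lattice_paths_def catalan_path_Nil zero_prod_def)
  next
    case (snoc ys s)
    have "sum_list ys + s = (n, m) \<longleftrightarrow>
      fst s \<le> n \<and> snd s \<le> m \<and> sum_list ys = (n - fst s, m - snd s)"
      by (cases s; cases "sum_list ys") auto
    then have "xs \<in> ?L \<longleftrightarrow> s \<in> St \<and> ys \<in> catalan_queen_paths_to I (n - fst s) (m - snd s)"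
      using assms(1) snoc
      by (auto simp: catalan_queen_paths_to_def lattice_paths_def catalan_path_snoc St)
    then show ?thesis using snoc by auto
  qed
qed

lemma queen_count_rec:
  assumes I: "I \<subseteq> {1..}" and "n \<le> m"
  shows "queen_count I n m = (if n = 0 \<and> m = 0 then 1 else 0)
    + (\<Sum>a=1..n. queen_count I (n - a) m) + (\<Sum>a=1..m. queen_count I n (m - a))
    + (\<Sum>a\<in>{a \<in> I. a \<le> n}. queen_count I (n - a) (m - a))"
proof -
  let ?h = "\<lambda>a. (a, 0::nat)" and ?v = "\<lambda>a. (0::nat, a)" and ?d = "\<lambda>a::nat. (a, a)"
  let ?St = "?h ` {1..n} \<union> ?v ` {1..m} \<union> ?d ` {a \<in> I. a \<le> n}"
  let ?c = "\<lambda>s. queen_count I (n - fst s) (m - snd s)"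
  let ?P = "\<lambda>s. (\<lambda>ys. ys @ [s]) ` catalan_queen_paths_to I (n - fst s) (m - snd s)"
  note fin = finite_catalan_queen_paths_to[OF I]
  have finSt: "finite ?St" by simp
  have "card (\<Union>s\<in>?St. ?P s) = (\<Sum>s\<in>?St. card (?P s))"
    using fin by (intro card_UN_disjoint) auto
  moreover have "card (?P s) = card (catalan_queen_paths_to I (n - fst s) (m - snd s))" for s
    by (intro card_image inj_onI) simp
  ultimately have U: "of_nat (card (\<Union>s\<in>?St. ?P s)) = (\<Sum>s\<in>?St. ?c s)"
    by (simp add: queen_count_def)
  have "card (catalan_queen_paths_to I n m) =
    card (if (n, m) = (0, 0) then {[]} else {} :: (nat \<times> nat) list set) + card (\<Union>s\<in>?St. ?P s)"
    unfolding catalan_queen_paths_to_last_step[OF assms(2)]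
    using fin by (intro card_Un_disjoint) auto
  then have "queen_count I n m = (if n = 0 \<and> m = 0 then 1 else 0) + (\<Sum>s\<in>?St. ?c s)"
    using U by (simp add: queen_count_def)
  \<comment> \<open>The three families are disjoint because no step is zero, for diagonal steps by
    \<open>I \<subseteq> {1..}\<close>.\<close>
  also have "(\<Sum>s\<in>?St. ?c s) =
    (\<Sum>s\<in>?h ` {1..n}. ?c s) + (\<Sum>s\<in>?v ` {1..m}. ?c s) + (\<Sum>s\<in>?d ` {a \<in> I. a \<le> n}. ?c s)"
    using I by (subst sum.union_disjoint; (force | subst sum.union_disjoint; force)?)
  also have "\<dots> = (\<Sum>a=1..n. queen_count I (n - a) m) + (\<Sum>a=1..m. queen_count I n (m - a))
    + (\<Sum>a\<in>{a \<in> I. a \<le> n}. queen_count I (n - a) (m - a))"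
    by (subst (1 2 3) sum.reindex) (auto simp: inj_on_def)
  finally show ?thesis by (simp add: add.assoc)
qed

section \<open>The linear system for the level generating functions, and its solution\<close>

definition level_gf :: "nat set \<Rightarrow> nat \<Rightarrow> rat fps" where
  "level_gf I d = Abs_fps (\<lambda>n. queen_count I n (n + d))"

text \<open>The series V_d in coefficients: the coefficient of t^n in t^k F_(d+k) counts paths to (n
  - k, n + d), which a horizontal step of length k extends to (n, n + d).\<close>

definition above_gf :: "nat set \<Rightarrow> nat \<Rightarrow> rat fps" where
  "above_gf I d = Abs_fps (\<lambda>n. \<Sum>k=1..n. queen_count I (n - k) (n + d))"

text \<open>The term k = 1 gives t F_(d+1); the others, reindexed by k - 1, give t V_(d+1).\<close>

lemma above_gf_rec: "above_gf I d = fps_X * (level_gf I (Suc d) + above_gf I (Suc d))"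
proof (rule fps_ext)
  fix n
  show "fps_nth (above_gf I d) n = fps_nth (fps_X * (level_gf I (Suc d) + above_gf I (Suc d))) n"
  proof (cases n)
    case 0
    then show ?thesis by (simp add: above_gf_def)
  next
    case (Suc k)
    have "fps_nth (above_gf I d) n = (\<Sum>j=0..k. queen_count I (k - j) (k + Suc d))"
      unfolding above_gf_def Suc fps_nth_Abs_fps One_nat_def sum.shift_bounds_cl_Suc_ivl by simp
    also have "\<dots> = queen_count I k (k + Suc d) + (\<Sum>j=1..k. queen_count I (k - j) (k + Suc d))"
      by (subst sum.atLeast_Suc_atMost) auto
    finally show ?thesis by (simp add: Suc level_gf_def above_gf_def)
  qed
qed

text \<open>Diagonal last steps keep d, which gives a product with T that is moved to the left side.
  Vertical ones come from levels e < d, horizontal ones from levels above d.\<close>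

lemma level_gf_rec:
  assumes I: "I \<subseteq> {1..}"
  shows "(1 - Abs_fps (\<lambda>a. if a \<in> I then 1 else 0)) * level_gf I d =
    of_bool (d = 0) + (\<Sum>e<d. level_gf I e) + above_gf I d"
proof -
  let ?T = "Abs_fps (\<lambda>a. if a \<in> I then 1 else 0) :: rat fps"
  have "level_gf I d = of_bool (d = 0) + (\<Sum>e<d. level_gf I e) + above_gf I d + ?T * level_gf I d"
  proof (rule fps_ext)
    fix n
    have "(\<Sum>a=1..n+d. queen_count I n (n + d - a)) = (\<Sum>j<n+d. queen_count I n j)"
      by (rule sum.reindex_bij_witness[of _ "\<lambda>j. n + d - j" "\<lambda>a. n + d - a"]) auto
    \<comment> \<open>No Catalan path reaches a point below the diagonal.\<close>
    also have "\<dots> = (\<Sum>j\<in>{n..<n+d}. queen_count I n j)"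
      by (rule sum.mono_neutral_right) (auto simp: queen_count_eq_0)
    also have "\<dots> = (\<Sum>e<d. queen_count I n (n + e))"
      by (rule sum.reindex_bij_witness[of _ "\<lambda>e. n + e" "\<lambda>j. j - n"]) auto
    finally have v: "(\<Sum>a=1..n+d. queen_count I n (n + d - a)) = (\<Sum>e<d. queen_count I n (n + e))" .
    have "(\<Sum>a\<in>{a \<in> I. a \<le> n}. queen_count I (n - a) (n + d - a)) =
      (\<Sum>a\<in>{a \<in> I. a \<le> n}. queen_count I (n - a) (n - a + d))"
      by (intro sum.cong) auto
    also have "\<dots> = (\<Sum>a=0..n. (if a \<in> I then 1 else 0) * queen_count I (n - a) (n - a + d))"
      by (rule sum.mono_neutral_cong_left) auto
    also have "\<dots> = fps_nth (?T * level_gf I d) n"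
      by (simp add: fps_mult_nth level_gf_def)
    finally have dg: "(\<Sum>a\<in>{a \<in> I. a \<le> n}. queen_count I (n - a) (n + d - a)) =
      fps_nth (?T * level_gf I d) n" .
    show "fps_nth (level_gf I d) n = fps_nth (of_bool (d = 0) + (\<Sum>e<d. level_gf I e)
      + above_gf I d + ?T * level_gf I d) n"
      using queen_count_rec[OF I, of n "n + d"]
      unfolding v dg by (simp add: level_gf_def above_gf_def fps_sum_nth)
  qed
  then show ?thesis by (simp add: algebra_simps)
qed

text \<open>The equations determine the coefficients by recursion on the pair \<open>(n, d)\<close>, in
  lexicographic order; inside each level \<open>n\<close>, those of \<open>V\<close> come before those of \<open>F\<close>.\<close>
lemma kernel_system_unique:
  fixes C :: "'a::field fps" and F V G U :: "nat \<Rightarrow> 'a fps"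
  assumes C: "fps_nth C 0 = 1"
    and F: "\<And>d. C * F d = K d + (\<Sum>e<d. F e) + V d"
    and V: "\<And>d. V d = fps_X * (F (Suc d) + V (Suc d))"
    and G: "\<And>d. C * G d = K d + (\<Sum>e<d. G e) + U d"
    and U: "\<And>d. U d = fps_X * (G (Suc d) + U (Suc d))"
  shows "F d = G d"
proof -
  have "\<forall>d. fps_nth (V d) n = fps_nth (U d) n \<and> fps_nth (F d) n = fps_nth (G d) n" for n
  proof (induction n rule: less_induct)
    case (less n)
    \<comment> \<open>The factor \<open>fps_X\<close> lowers the index to n - 1, where the induction
      hypothesis covers all d; at n = 0 both sides vanish.\<close>
    have VU: "fps_nth (V d) n = fps_nth (U d) n" for d
      using less.IH[of "n - 1"] by (subst V, subst U) simp
    have "fps_nth (F d) n = fps_nth (G d) n" for d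
    proof (induction d rule: less_induct)
      case (less d)
      \<comment> \<open>The constant term 1 of \<open>C\<close> isolates coefficient n of
        \<open>H\<close>; the remaining sum involves smaller indices only, settled by the outer
        hypothesis.\<close>
      have lower: "fps_nth (C * H) n = fps_nth H n + (\<Sum>i=1..n. fps_nth C i * fps_nth H (n - i))" for H
        unfolding fps_mult_nth by (subst sum.atLeast_Suc_atMost) (auto simp: C)
      have "fps_nth (C * F d) n = fps_nth (C * G d) n"
        unfolding F G using less VU by (simp add: fps_sum_nth)
      moreover have "(\<Sum>i=1..n. fps_nth C i * fps_nth (F d) (n - i)) =
        (\<Sum>i=1..n. fps_nth C i * fps_nth (G d) (n - i))"
        using \<open>\<And>y. y < n \<Longrightarrow> _\<close> by (intro sum.cong) auto
      ultimately show ?case by (simp add: lower)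
    qed
    with VU show ?case by blast
  qed
  then show ?thesis by (simp add: fps_eq_iff)
qed

text \<open>The level series times \<open>W\<close> and an explicit sequence \<open>G\<close>,
  geometric in \<open>b\<close> from d = 1 on, solve the same system with source \<open>W\<close> at
  d = 0, so uniqueness identifies them. The equation for d = 1 dictates \<open>D\<close>, and the
  one for d = 0 then dictates \<open>W\<close>.\<close>

lemma catalan_queen_gf_closed_form:
  fixes b C :: "rat fps"
  assumes I: "I \<subseteq> {1..}"
    and C: "C = 1 - Abs_fps (\<lambda>a. if a \<in> I then 1 else 0)"
    and quad: "(1 + C) * fps_X * b^2 - (C + (C + 2) * fps_X) * b + (1 + C) = 0"
  defines "D \<equiv> C - (1 + C) * fps_X * b"
  shows "(C * D - fps_X) * catalan_queen_gf I = D"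
proof -
  let ?X = "fps_X :: rat fps"
  define W where "W = C * D - ?X"
  \<comment> \<open>the solution scaled by \<open>W\<close>, to avoid dividing by it\<close>
  define G where "G = case_nat D (\<lambda>d. (1 - ?X * b) * b^d)"
  have C0: "fps_nth C 0 = 1" using I by (auto simp: C)
  have F: "C * (W * level_gf I d) = W * of_bool (d = 0) + (\<Sum>e<d. W * level_gf I e)
    + W * above_gf I d" for d
    using arg_cong[OF level_gf_rec[OF I, of d, folded C], of "(*) W"]
    by (simp only: sum_distrib_left[symmetric] distrib_left mult.left_commute)
  have V: "W * above_gf I d = ?X * (W * level_gf I (Suc d) + W * above_gf I (Suc d))" for d
    by (subst above_gf_rec) (simp add: algebra_simps)
  \<comment> \<open>This is \<open>quad\<close> rearranged: the difference of the equations for d +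
    2 and d + 1, with the factor \<open>b^d\<close> removed.\<close>
  have step: "C * (1 - ?X * b) * (b - 1) = 1 - ?X * b + ?X * b * (b - 1)"
    using quad by (simp add: algebra_simps power2_eq_square)
  have *: "C * G (Suc d) = (\<Sum>e<Suc d. G e) + ?X * b^Suc d" for d
  proof (induction d)
    case 0
    show ?case by (simp add: G_def D_def algebra_simps)
  next
    case (Suc d)
    have "C * G (Suc (Suc d)) = C * G (Suc d) + C * (1 - ?X * b) * (b - 1) * b^d"
      by (simp add: G_def algebra_simps)
    also have "\<dots> = (\<Sum>e<Suc (Suc d). G e) + ?X * b^Suc (Suc d)"
      unfolding Suc step by (simp add: G_def algebra_simps)
    finally show ?case .
  qed
  have G: "C * G d = W * of_bool (d = 0) + (\<Sum>e<d. G e) + ?X * b^d" for d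
  proof (cases d)
    case 0
    then show ?thesis by (simp add: G_def W_def)
  next
    case (Suc k)
    then show ?thesis using *[of k] by simp
  qed
  have U: "?X * b^d = ?X * (G (Suc d) + ?X * b^Suc d)" for d
    by (simp add: G_def algebra_simps)
  have "W * level_gf I 0 = G 0"
    by (rule kernel_system_unique[OF C0 F V G U])
  moreover have "level_gf I 0 = catalan_queen_gf I"
    by (simp add: level_gf_def catalan_queen_gf_def queen_count_def
        catalan_queen_paths_to_def catalan_queen_paths_def)
  ultimately show ?thesis by (simp add: G_def W_def)
qed


section \<open>From the closed form to the stated formula\<close>

text \<open>Here \<open>a\<close> stands for \<open>t \<alpha>\<close>, which unlike \<open>\<alpha>\<close> is a power series, and \<open>b\<close> for \<open>\<beta>\<close>.\<close>
lemma kernel_root_identity: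
  fixes a b t C :: "'a::field"
  assumes prod: "a * b = 1" and sum: "(1 + C) * (a + t * b) = C + (C + 2) * t"
    and nz: "t \<noteq> 0" "1 + C \<noteq> 0" "t - a \<noteq> 0" "a - t * b \<noteq> 0"
    and E: "(1 + C) * (a - t * b) * (t - a) + t * (t - 1) \<noteq> 0"
    and D: "D = C - (1 + C) * t * b" and W: "C * D - t \<noteq> 0"
    and \<alpha>: "\<alpha> = a / t" and A: "A = \<alpha> * (t - 1) / ((1 + C) * (\<alpha> - b))"
  shows "(1 + A / (t * (1 - \<alpha>))) / (1 + C + (1 + C) * A / (t * \<alpha> * (1 - \<alpha>))) = D / (C * D - t)"
proof -
  \<comment> \<open>A common denominator for both parts of the claimed quotient, so that it
    cancels.\<close>
  define K where "K = (1 + C) * (a - t * b) * (t - a)"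
  have K: "K \<noteq> 0" using nz by (simp add: K_def)
  have a0: "a \<noteq> 0" using prod by auto
  have A': "A = a * (t - 1) / ((1 + C) * (a - t * b))"
  proof -
    have "\<alpha> - b = (a - t * b) / t" using nz by (simp add: \<alpha> field_simps)
    then show ?thesis using nz by (simp add: A \<alpha>)
  qed
  have t1: "t * (1 - \<alpha>) = t - a" using nz by (simp add: \<alpha> field_simps)
  have "A / (t * (1 - \<alpha>)) = a * (t - 1) / K"
    unfolding t1 A' K_def by simp
  then have num: "1 + A / (t * (1 - \<alpha>)) = (K + a * (t - 1)) / K"
    using K by (simp add: field_simps)
  have t2: "t * \<alpha> * (1 - \<alpha>) = a * (t - a) / t" using nz by (simp add: \<alpha> field_simps)
  have "(1 + C) * A / (t * \<alpha> * (1 - \<alpha>)) = (1 + C) * (t * (t - 1)) / K"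
    unfolding t2 A' K_def using nz a0 by simp
  then have den: "1 + C + (1 + C) * A / (t * \<alpha> * (1 - \<alpha>)) = (1 + C) * (K + t * (t - 1)) / K"
    using K by (simp add: field_simps)
  \<comment> \<open>With denominators cleared, a polynomial identity modulo \<open>prod\<close> and
    \<open>sum\<close>, which are Vieta's formulas for the characteristic quadratic.\<close>
  have "D * ((1 + C) * (K + t * (t - 1))) = (C * D - t) * (K + a * (t - 1))"
    unfolding D K_def using prod sum by algebra
  then show ?thesis
    unfolding num den using K W E[folded K_def] nz(2) by (simp add: frac_eq_eq mult.commute)
qed

theorem mainTheorem3:
  fixes I :: "nat set"
    and T\<^sub>0 C\<^sub>0 R\<^sub>0 :: "rat fps"
    and t T C R \<alpha> \<beta> A :: "rat fls"
  assumes "I \<subseteq> {1..}"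
    and "T\<^sub>0 = Abs_fps (\<lambda>a. if a \<in> I then 1 else 0)"
    and "C\<^sub>0 = 1 - T\<^sub>0"
    and "R\<^sub>0 = fps_sqrt (C\<^sub>0^2 - (2 * C\<^sub>0^2 + 4 * C\<^sub>0 + 4) * fps_X + (C\<^sub>0 + 2)^2 * fps_X^2)"
    and "t = fls_X"
    and "T = fps_to_fls T\<^sub>0"
    and "C = fps_to_fls C\<^sub>0"
    and "R = fps_to_fls R\<^sub>0"
    and "\<alpha> = (C + (C + 2) * t + R) / (2 * (1 + C) * t)"
    and "\<beta> = (C + (C + 2) * t - R) / (2 * (1 + C) * t)"
    and "A = \<alpha> * (t - 1) / ((1 + C) * (\<alpha> - \<beta>))"
  shows "fps_to_fls (catalan_queen_gf I) =
    (1 + A / (t * (1 - \<alpha>))) / (1 + C + (2 - T) * A / (t * \<alpha> * (1 - \<alpha>)))"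
proof -
  let ?X = "fps_X :: rat fps"
  have C0: "fps_nth C\<^sub>0 0 = 1" using assms(1-3) by auto
  have R: "R\<^sub>0^2 = C\<^sub>0^2 - (2 * C\<^sub>0^2 + 4 * C\<^sub>0 + 4) * ?X + (C\<^sub>0 + 2)^2 * ?X^2"
    and R0: "fps_nth R\<^sub>0 0 = 1"
    unfolding assms(4) by (rule fps_sqrt_correct; simp add: C0 fps_power_zeroth)+
  define N where "N = C\<^sub>0 + (C\<^sub>0 + 2) * ?X - R\<^sub>0"
  \<comment> \<open>The shift divides by \<open>fps_X\<close> exactly, since \<open>N\<close> has
    constant term 1 - 1 = 0. With the plus sign the constant term is 2, so only t \<alpha> is a
    power series.\<close>
  define b where "b = fps_shift 1 N * inverse (2 * (1 + C\<^sub>0))"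
  define a where "a = (C\<^sub>0 + (C\<^sub>0 + 2) * ?X + R\<^sub>0) * inverse (2 * (1 + C\<^sub>0))"
  have inv: "2 * (1 + C\<^sub>0) * inverse (2 * (1 + C\<^sub>0)) = 1"
    by (rule inverse_mult_eq_1') (simp add: C0)
  have N: "?X * fps_shift 1 N = N"
    by (rule fps_ext) (simp add: N_def C0 R0)
  have b: "2 * (1 + C\<^sub>0) * ?X * b = C\<^sub>0 + (C\<^sub>0 + 2) * ?X - R\<^sub>0"
    unfolding N_def[symmetric] using inv N unfolding b_def by algebra
  have a: "2 * (1 + C\<^sub>0) * a = C\<^sub>0 + (C\<^sub>0 + 2) * ?X + R\<^sub>0"
    using inv unfolding a_def by algebra
  have u: "1 + C\<^sub>0 \<noteq> 0"
    using C0 by (metis fps_add_nth fps_one_nth fps_zero_nth one_add_one zero_neq_numeral)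
  \<comment> \<open>The radicand is the discriminant of this quadratic; four times the leading
    coefficient completes the square and is cancelled afterwards.\<close>
  have "4 * (1 + C\<^sub>0) * ?X * ((1 + C\<^sub>0) * ?X * b^2 - (C\<^sub>0 + (C\<^sub>0 + 2) * ?X) * b + (1 + C\<^sub>0)) = 0"
    using b R by algebra
  then have quad: "(1 + C\<^sub>0) * ?X * b^2 - (C\<^sub>0 + (C\<^sub>0 + 2) * ?X) * b + (1 + C\<^sub>0) = 0"
    using u by (simp del: distrib_left_numeral)
  have "4 * (1 + C\<^sub>0)^2 * ?X * (a * b) = 4 * (1 + C\<^sub>0)^2 * ?X * 1"
    using a b R by algebra
  then have ab: "a * b = 1" using u by simp
  have "2 * ((1 + C\<^sub>0) * (a + ?X * b)) = 2 * (C\<^sub>0 + (C\<^sub>0 + 2) * ?X)"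
    using a b by algebra
  then have s: "(1 + C\<^sub>0) * (a + ?X * b) = C\<^sub>0 + (C\<^sub>0 + 2) * ?X"
    by (simp del: distrib_left_numeral)
  have a0: "fps_nth a 0 = 1 / 2"
    using arg_cong[OF a, of "\<lambda>f. fps_nth f 0"] by (simp add: C0 R0)
  define D where "D = C\<^sub>0 - (1 + C\<^sub>0) * ?X * b"
  have gf: "(C\<^sub>0 * D - ?X) * catalan_queen_gf I = D"
    unfolding D_def using assms(1-3) quad by (intro catalan_queen_gf_closed_form) auto
  \<comment> \<open>Nonvanishing is read off constant terms: 1 for \<open>W\<close>, and -1/2, 1/2,
    -1/2 for the three claims \<open>nz\<close>.\<close>
  have nonzero: "f \<noteq> 0" if "fps_nth f 0 \<noteq> 0" for f :: "rat fps" using that by auto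
  have W: "C\<^sub>0 * D - ?X \<noteq> 0"
    by (rule nonzero) (simp add: D_def C0)
  have nz: "?X - a \<noteq> 0" "a - ?X * b \<noteq> 0"
    "(1 + C\<^sub>0) * (a - ?X * b) * (?X - a) + ?X * (?X - 1) \<noteq> 0"
    by (rule nonzero; simp add: a0 C0)+
  \<comment> \<open>The identities hold among power series and are carried along the ring embedding
    into Laurent series, where division is possible.\<close>
  note hom = fls_times_fps_to_fls fps_to_fls_plus fps_to_fls_minus fps_one_to_fls
    fps_X_to_fls fps_to_fls_numeral
  note to_fls = arg_cong[of _ _ fps_to_fls]
  have t0: "t \<noteq> 0" by (simp add: assms(5))
  have uC: "1 + C \<noteq> 0"
    using fps_to_fls_nonzeroI[OF u] by (simp add: assms(7))
  then have 2: "2 * (1 + C) \<noteq> 0"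
    by (metis mult_eq_0_iff zero_neq_numeral)
  have \<alpha>: "\<alpha> = fps_to_fls a / t"
  proof -
    have "2 * (1 + C) * fps_to_fls a = C + (C + 2) * t + R"
      using to_fls[OF a] by (simp only: hom assms(5-8))
    then have "\<alpha> = (2 * (1 + C)) * fps_to_fls a / ((2 * (1 + C)) * t)"
      unfolding assms(9) by (simp only:)
    then show ?thesis by (simp only: mult_divide_mult_cancel_left[OF 2])
  qed
  have \<beta>: "\<beta> = fps_to_fls b"
  proof -
    have "2 * (1 + C) * t * fps_to_fls b = C + (C + 2) * t - R"
      using to_fls[OF b] by (simp only: hom assms(5-8))
    then have "\<beta> = (2 * (1 + C) * t) * fps_to_fls b / (2 * (1 + C) * t)"
      unfolding assms(10) by (simp only:)
    moreover have "2 * (1 + C) * t \<noteq> 0" using 2 t0 by (metis mult_eq_0_iff)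
    ultimately show ?thesis by (metis mult_divide_mult_cancel_left div_by_1 mult_1_right)
  qed
  have W': "C * fps_to_fls D - t \<noteq> 0"
    using fps_to_fls_nonzeroI[OF W] by (simp only: hom not_False_eq_True assms(5,7))
  have "(C * fps_to_fls D - t) * fps_to_fls (catalan_queen_gf I) = fps_to_fls D"
    using to_fls[OF gf] by (simp only: hom assms(5,7))
  then have "fps_to_fls (catalan_queen_gf I) = fps_to_fls D / (C * fps_to_fls D - t)"
    using W' by (simp add: eq_divide_eq mult.commute)
  also have "\<dots> = (1 + A / (t * (1 - \<alpha>))) / (1 + C + (1 + C) * A / (t * \<alpha> * (1 - \<alpha>)))"
  proof (rule kernel_root_identity[symmetric])
    show "fps_to_fls a * fps_to_fls b = 1"
      using to_fls[OF ab] by (simp only: hom)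
    show "(1 + C) * (fps_to_fls a + t * fps_to_fls b) = C + (C + 2) * t"
      using to_fls[OF s] by (simp only: hom assms(5,7))
    show "t - fps_to_fls a \<noteq> 0"
      using fps_to_fls_nonzeroI[OF nz(1)] by (simp only: hom not_False_eq_True assms(5))
    show "fps_to_fls a - t * fps_to_fls b \<noteq> 0"
      using fps_to_fls_nonzeroI[OF nz(2)] by (simp only: hom not_False_eq_True assms(5))
    show "(1 + C) * (fps_to_fls a - t * fps_to_fls b) * (t - fps_to_fls a) + t * (t - 1) \<noteq> 0"
      using fps_to_fls_nonzeroI[OF nz(3)] by (simp only: hom not_False_eq_True assms(5,7))
    show "fps_to_fls D = C - (1 + C) * t * fps_to_fls b"
      using to_fls[OF D_def] by (simp only: hom assms(5,7))
    show "A = \<alpha> * (t - 1) / ((1 + C) * (\<alpha> - fps_to_fls b))"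
      using assms(11) by (simp only: \<beta>)
  qed (use t0 uC W' \<alpha> in auto)
  also have "(1 + C) * A = (2 - T) * A" by (simp add: assms(3,6,7))
  finally show ?thesis .
qed

end
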